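(* Let $\alpha,\beta,\gamma,m_0,m_1,x_0\in\mathbb{R}$ with $\alpha m_1>0$, and consider the system $$\dot x=\alpha(m_0-1)x+\alpha y-\alpha m_1x^3+\alpha x_0,\qquad \dot y=x-y+z,\qquad \dot z=\beta y-\gamma z$$ on $\mathbb{R}^3$. Let $J(0)=\begin{pmatrix}\alpha(m_0-1)&\alpha&0\\1&-1&1\\0&\beta&-\gamma\end{pmatrix}$ be the Jacobian matrix of its right-hand side at the origin, and let $\lambda_1(0)\ge\lambda_2(0)\ge\lambda_3(0)$ be the eigenvalues, counted with multiplicity, of the symmetric matrix $\tfrac12\big(J(0)+J(0)^{*}\big)$. If $$\lambda_1(0)+\lambda_2(0)<0,$$ then any bounded solution of the system tends to the stationary set as $t\to+\infty$.
   Context: Standing assumption: solutions of the system exist and are unique for $t\in[0,+\infty)$; bounded means bounded on $[0,+\infty)$. The stationary set is the set of all equilibria of the system, and a solution tends to it as $t\to+\infty$ if the distance from the solution at time $t$ to this set tends to $0$. The star denotes the transpose. *)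

theory Defs
  imports "HOL-Analysis.Analysis" "HOL-Computational_Algebra.Polynomial"
begin

definition char_polynomial :: "'a::comm_ring_1 ^ 'n ^ 'n \<Rightarrow> 'a poly"
  where "char_polynomial A = det (mat [:0, 1:] - map_matrix (\<lambda>a. [:a:]) A)"

(* Only the eigenvalues lying in the field 'a are listed; for a symmetric real matrix
   these are all of them. *)
definition eigenvalues_mset :: "'a::field ^ 'n ^ 'n \<Rightarrow> 'a multiset"
  where "eigenvalues_mset A = proots (char_polynomial A)"

definition symmetric_part :: "real ^ 'n ^ 'n \<Rightarrow> real ^ 'n ^ 'n"
  where "symmetric_part A = (1/2) *\<^sub>R (A + transpose A)"

(* Solutions are considered on [0, +infinity) only; values at negative times are irrelevant
   (at t = 0 the derivative is one-sided). *)
definition solution :: "('a::real_normed_vector \<Rightarrow> 'a) \<Rightarrow> (real \<Rightarrow> 'a) \<Rightarrow> bool"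
  where "solution f u \<longleftrightarrow> (\<forall>t\<ge>0. (u has_vector_derivative f (u t)) (at t within {0..}))"

definition uniquely_solvable :: "('a::real_normed_vector \<Rightarrow> 'a) \<Rightarrow> bool"
  where "uniquely_solvable f \<longleftrightarrow>
    (\<forall>p. \<exists>u. solution f u \<and> u 0 = p) \<and>
    (\<forall>u v. solution f u \<longrightarrow> solution f v \<longrightarrow> u 0 = v 0 \<longrightarrow> (\<forall>t\<ge>0. u t = v t))"

definition stationary_set :: "('a::real_normed_vector \<Rightarrow> 'a) \<Rightarrow> 'a set"
  where "stationary_set f = {p. f p = 0}"

definition tends_to_set :: "(real \<Rightarrow> 'a::metric_space) \<Rightarrow> 'a set \<Rightarrow> bool"
  where "tends_to_set u S \<longleftrightarrow> ((\<lambda>t. infdist (u t) S) \<longlongrightarrow> 0) at_top"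

definition chua :: "real \<Rightarrow> real \<Rightarrow> real \<Rightarrow> real \<Rightarrow> real \<Rightarrow> real \<Rightarrow> real ^ 3 \<Rightarrow> real ^ 3"
  where "chua \<alpha> \<beta> \<gamma> m0 m1 x0 p =
    (let x = p $ 1; y = p $ 2; z = p $ 3 in
      vector [\<alpha> * (m0 - 1) * x + \<alpha> * y - \<alpha> * m1 * x ^ 3 + \<alpha> * x0,
              x - y + z,
              \<beta> * y - \<gamma> * z])"

definition chua_J0 :: "real \<Rightarrow> real \<Rightarrow> real \<Rightarrow> real \<Rightarrow> real ^ 3 ^ 3"
  where "chua_J0 \<alpha> \<beta> \<gamma> m0 =
    vector [vector [\<alpha> * (m0 - 1), \<alpha>, 0],
            vector [1, -1, 1],
            vector [0, \<beta>, -\<gamma>]]"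

lemma chua_has_derivative_0:
  "(chua \<alpha> \<beta> \<gamma> m0 m1 x0 has_derivative (\<lambda>h. chua_J0 \<alpha> \<beta> \<gamma> m0 *v h)) (at 0)"
proof (subst has_derivative_componentwise_within, rule ballI)
  fix b :: "real ^ 3" assume "b \<in> Basis"
  then obtain i where b: "b = axis i 1" by (auto simp: Basis_vec_def)
  have nth: "((\<lambda>p. p $ j) has_derivative (\<lambda>h. h $ j)) (at 0)" for j :: 3
    by (rule bounded_linear_imp_has_derivative) (rule bounded_linear_vec_nth)
  have "((\<lambda>p. chua \<alpha> \<beta> \<gamma> m0 m1 x0 p $ i) has_derivative (\<lambda>h. (chua_J0 \<alpha> \<beta> \<gamma> m0 *v h) $ i)) (at 0)"
  proof -
    consider "i = 1" | "i = 2" | "i = 3" using exhaust_3 by blast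
    then show ?thesis
      by cases (auto simp: chua_def chua_J0_def Let_def matrix_vector_mult_def sum_3 algebra_simps
          intro!: derivative_eq_intros nth)
  qed
  then show "((\<lambda>p. chua \<alpha> \<beta> \<gamma> m0 m1 x0 p \<bullet> b) has_derivative (\<lambda>h. (chua_J0 \<alpha> \<beta> \<gamma> m0 *v h) \<bullet> b)) (at 0)"
    by (simp add: b inner_axis)
qed

lemma jacobian_chua_0: "jacobian (chua \<alpha> \<beta> \<gamma> m0 m1 x0) (at 0) = chua_J0 \<alpha> \<beta> \<gamma> m0"
  unfolding jacobian_def
  by (simp flip: frechet_derivative_at[OF chua_has_derivative_0])

(* Since infdist p {} = 0, tends_to_set would be trivial for an empty set. The stationary set
   of this system is never empty: a real cubic has a root. *)
lemma real_cubic_root: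
  fixes a b c :: real
  assumes "a > 0"
  shows "\<exists>x. a * x ^ 3 + b * x + c = 0"
proof -
  have "\<exists>r s. a * r ^ 3 + b * r + c \<le> 0 \<and> 0 \<le> a * s ^ 3 + b * s + c \<and> r \<le> s"
  proof -
    define K where "K = 1 + (\<bar>b\<bar> + \<bar>c\<bar>) / a"
    have K: "K \<ge> 1" "a * K \<ge> \<bar>b\<bar> + \<bar>c\<bar>" using assms by (auto simp: K_def field_simps)
    have "a * K ^ 3 = a * K * (K * K)" by (simp add: power3_eq_cube)
    also have "\<dots> \<ge> a * K * (1 * K)"
      using K assms by (intro mult_left_mono mult_right_mono) auto
    also have "a * K * (1 * K) \<ge> (\<bar>b\<bar> + \<bar>c\<bar>) * K"
      using K by (simp add: mult_right_mono)
    finally have 1: "a * K ^ 3 \<ge> \<bar>b\<bar> * K + \<bar>c\<bar> * K" by (simp add: algebra_simps)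
    have 2: "\<bar>c\<bar> * K \<ge> \<bar>c\<bar>" using mult_left_mono[OF K(1), of "\<bar>c\<bar>"] by simp
    have 3: "\<bar>b * K\<bar> = \<bar>b\<bar> * K" using K by (simp add: abs_mult)
    have "a * (- K) ^ 3 + b * (- K) + c \<le> 0" "a * K ^ 3 + b * K + c \<ge> 0"
      using 1 2 3 abs_ge_self[of "b * K"] abs_ge_minus_self[of "b * K"]
        abs_ge_self[of c] abs_ge_minus_self[of c]
      by (simp_all add: power3_eq_cube)
    then show ?thesis using K by (intro exI[of _ "- K"] exI[of _ K]) auto
  qed
  then obtain r s where "a * r ^ 3 + b * r + c \<le> 0" "0 \<le> a * s ^ 3 + b * s + c" "r \<le> s" by blast
  then show ?thesis
    using IVT'[of "\<lambda>x. a * x ^ 3 + b * x + c" r 0 s] by (force intro!: continuous_intros)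
qed

lemma stationary_set_chua_nonempty:
  assumes "\<alpha> * m1 > 0"
  shows "stationary_set (chua \<alpha> \<beta> \<gamma> m0 m1 x0) \<noteq> {}"
proof -
  have E: "\<exists>p. chua \<alpha> \<beta> \<gamma> m0 m1 x0 p = 0"
    if "\<alpha> * (m0 - 1) * x + \<alpha> * y - \<alpha> * m1 * x ^ 3 + \<alpha> * x0 = 0" "x - y + z = 0" "\<beta> * y - \<gamma> * z = 0"
    for x y z
    using that by (intro exI[of _ "vector [x, y, z]"]) (simp add: chua_def vec_eq_iff forall_3)
  have C: "\<exists>x. \<alpha> * (m0 - 1) * x + \<alpha> * (k * x) - \<alpha> * m1 * x ^ 3 + \<alpha> * x0 = 0" for k
    using real_cubic_root[OF assms, of "- (\<alpha> * (m0 - 1) + \<alpha> * k)" "- (\<alpha> * x0)"]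
    by (elim ex_forward) (simp add: algebra_simps)
  have "\<exists>p. chua \<alpha> \<beta> \<gamma> m0 m1 x0 p = 0"
  proof (cases "\<gamma> = \<beta>")
    case True
    show ?thesis by (rule E[of 0 "- x0" "- x0"]) (simp_all add: True)
  next
    case False
    define k where "k = \<gamma> / (\<gamma> - \<beta>)"
    obtain x where "\<alpha> * (m0 - 1) * x + \<alpha> * (k * x) - \<alpha> * m1 * x ^ 3 + \<alpha> * x0 = 0" using C by blast
    then show ?thesis
      by (rule E[where z = "k * x - x"]) (use False in \<open>auto simp: k_def field_simps\<close>)
  qed
  then show ?thesis by (simp add: stationary_set_def)
qed

end

theory Submission
  imports Defs
begin

text \<open>
  Let \<open>v = u'\<close> be the speed of a bounded solution. If the integral of \<open>|v|\<^sup>2\<close> diverges, a limit point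
  \<open>R\<close> of the normalised matrices \<open>\<integral> v v\<^sup>T\<close> over \<open>[0, T]\<close> is a nonzero positive semidefinite matrix, and
  every bounded function whose derivative along the solution is quadratic in \<open>v\<close> gives a linear
  relation for \<open>R\<close>. The squares and products of the components of \<open>v\<close>, for which the cubic term has a
  favourable sign or does not occur, and the potential of the system viewed as a gradient flow for
  an indefinite metric give enough relations to contradict the spectral hypothesis. So the
  integral of \<open>|v|\<^sup>2\<close> converges, \<open>v\<close> tends to 0 by Barbalat's argument, and compactness finishes
  the proof.
\<close>

section \<open>The spectral hypothesis\<close>

lemma prod_linear_proots_dvd:
  fixes P :: "'a::field poly"
  assumes "P \<noteq> 0"
  shows "(\<Prod>x\<in>#proots P. [:- x, 1:]) dvd P"
  using assms
proof (induction P rule: poly_root_order_induct)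
  case (no_roots P)
  then have "proots P = {#}" by (simp add: multiset_eqI order_root)
  then show ?case by simp
next
  case (root P x n)
  have "P \<noteq> 0" using root.hyps by auto
  then have "proots ([:- x, 1:] ^ n * P) = repeat_mset n {#x#} + proots P"
    by (simp add: proots_mult proots_power)
  moreover have "(\<Prod>y\<in>#repeat_mset n {#x#}. [:- y, 1:]) = [:- x, 1:] ^ n"
    by (induction n) simp_all
  ultimately show ?case using root.IH[OF \<open>P \<noteq> 0\<close>] by (simp add: mult_dvd_mono)
qed auto

text \<open>The linear factors divide \<open>P\<close>, and the cofactor has degree 0 and leading
  coefficient 1. This recovers the characteristic polynomial from the eigenvalue multiset once its
  size equals the degree.\<close>

lemma monic_split_poly:
  fixes P :: "'a::field poly"
  assumes "lead_coeff P = 1" "size (proots P) = degree P"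
  shows "P = (\<Prod>x\<in>#proots P. [:- x, 1:])"
proof -
  have P: "P \<noteq> 0" using assms by auto
  then obtain Q where Q: "P = (\<Prod>x\<in>#proots P. [:- x, 1:]) * Q"
    using prod_linear_proots_dvd by (blast elim: dvdE)
  have D: "degree (\<Prod>x\<in>#M. [:- x, 1:]) = size M" "lead_coeff (\<Prod>x\<in>#M. [:- x, 1:]) = 1"
    for M :: "'a multiset"
  proof (induction M)
    case (add x M)
    then have "(\<Prod>x\<in>#M. [:- x, 1:]) \<noteq> 0" by auto
    then have "degree ([:- x, 1:] * (\<Prod>x\<in>#M. [:- x, 1:])) = Suc (size M)"
      using add by (subst degree_mult_eq) auto
    moreover have "lead_coeff ([:- x, 1:] * (\<Prod>x\<in>#M. [:- x, 1:])) = 1"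
      using add by (simp only: lead_coeff_mult) simp
    ultimately show "degree (\<Prod>x\<in>#add_mset x M. [:- x, 1:]) = size (add_mset x M)"
      "lead_coeff (\<Prod>x\<in>#add_mset x M. [:- x, 1:]) = 1" by (simp_all del: mult_pCons_left)
  qed simp_all
  have "Q \<noteq> 0" "(\<Prod>x\<in>#proots P. [:- x, 1:]) \<noteq> 0" using P Q by auto
  then have "degree P = size (proots P) + degree Q"
    using D(1) degree_mult_eq Q by metis
  then have "degree Q = 0" using assms by simp
  moreover have "lead_coeff Q = 1" using Q D(2) assms lead_coeff_mult by (metis mult_1)
  ultimately have "Q = 1" by (metis degree_0_id lead_coeff_pCons(1) of_nat_1 one_pCons degree_eq_zeroE degree_pCons_0)
  then show ?thesis using Q by simp
qed

text \<open>The assumed expression is \<open>det (T + t I)\<close> for the tridiagonal matrix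
  \<open>T\<close> with diagonal \<open>p, q, r\<close> and off-diagonal entries
  \<open>b, c\<close>. So \<open>T\<close> has no nonpositive eigenvalue, and its principal minors
  are positive.\<close>

lemma symmetric_tridiagonal_posdef:
  fixes p q r b c :: real
  assumes "\<And>t. t \<ge> 0 \<Longrightarrow> (r + t) * (q + t) * (p + t) - c\<^sup>2 * (p + t) - b\<^sup>2 * (r + t) > 0"
  shows "p > 0" "q > 0" "r > 0" "p * q > b\<^sup>2" "q * r > c\<^sup>2"
proof -
  have p: "p > 0"
  proof (rule ccontr)
    assume "\<not> p > 0"
    \<comment> \<open>\<open>t = - p\<close> is admissible because \<open>p \<le> 0\<close>, and
      only the term with \<open>b\<close> survives; \<open>t = - r\<close> isolates \<open>c\<close>
      likewise.\<close>
    with assms[of "- p"] have "b\<^sup>2 * (r - p) < 0" by (simp add: algebra_simps)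
    then have "r < p" by (simp add: mult_less_0_iff not_less)
    with assms[of "- r"] \<open>\<not> p > 0\<close> have "c\<^sup>2 * (p - r) < 0" by (simp add: algebra_simps)
    then have "p < r" by (simp add: mult_less_0_iff not_less)
    with \<open>r < p\<close> show False by simp
  qed
  have r: "r > 0"
  proof (rule ccontr)
    assume "\<not> r > 0"
    with assms[of "- r"] have "c\<^sup>2 * (p - r) < 0" by (simp add: algebra_simps)
    then have "p < r" by (simp add: mult_less_0_iff not_less)
    with p \<open>\<not> r > 0\<close> show False by simp
  qed
  have d: "r * q * p > c\<^sup>2 * p + b\<^sup>2 * r" using assms[of 0] by simp
  have "p * q * r > b\<^sup>2 * r" "q * r * p > c\<^sup>2 * p" 
    using d p r by (smt (verit) mult.commute mult.left_commute mult_nonneg_nonneg zero_le_power2)+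
  then show pq: "p * q > b\<^sup>2" and "q * r > c\<^sup>2" using p r by (simp_all)
  show "p > 0" "r > 0" by fact+
  have "p * q > 0" using pq zero_le_power2[of b] by linarith
  then show "q > 0" using p by (simp add: zero_less_mult_iff)
qed

text \<open>For \<open>S\<close> the symmetric part of the Jacobian, \<open>S - tr(S) I\<close> has the eigenvalues
  \<open>-(l\<^sub>i + l\<^sub>j)\<close>, so the hypothesis says that this tridiagonal matrix, with diagonal
  \<open>(1 + \<gamma>, \<gamma> - a, 1 - a)\<close>, is positive definite.\<close>

lemma chua_spectral_condition:
  fixes \<alpha> \<beta> \<gamma> m0 l1 l2 l3 :: real
  defines "a \<equiv> \<alpha> * (m0 - 1)"
  assumes ev: "eigenvalues_mset (symmetric_part (chua_J0 \<alpha> \<beta> \<gamma> m0)) = {#l1, l2, l3#}"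
    and l: "l1 \<ge> l2" "l2 \<ge> l3" "l1 + l2 < 0"
  shows "1 - a > 0" "\<gamma> - a > 0" "1 + \<gamma> > 0"
    "4 * ((1 - a) * (\<gamma> - a)) > (1 + \<beta>)\<^sup>2" "4 * ((\<gamma> - a) * (1 + \<gamma>)) > (1 + \<alpha>)\<^sup>2"
proof -
  let ?P = "char_polynomial (symmetric_part (chua_J0 \<alpha> \<beta> \<gamma> m0))"
  let ?b = "(1 + \<beta>) / 2" and ?c = "(1 + \<alpha>) / 2"
  have P: "?P = [:-a, 1:] * [:1, 1:] * [:\<gamma>, 1:] - [:?b\<^sup>2:] * [:-a, 1:] - [:?c\<^sup>2:] * [:\<gamma>, 1:]"
    unfolding char_polynomial_def det_3 symmetric_part_def chua_J0_def a_def
    by (simp add: map_matrix_def mat_def transpose_def one_pCons power2_eq_square field_simps)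
  have "degree ?P = 3" "lead_coeff ?P = 1" unfolding P by (simp_all add: numeral_3_eq_3)
  then have fac: "poly ?P x = (x - l1) * (x - l2) * (x - l3)" for x
    using monic_split_poly[of ?P] ev unfolding eigenvalues_mset_def by (simp add: algebra_simps)
  have fac': "(x - a) * (x + 1) * (x + \<gamma>) - ?b\<^sup>2 * (x - a) - ?c\<^sup>2 * (x + \<gamma>) = (x - l1) * (x - l2) * (x - l3)" for x
    using fac[of x] unfolding P by (simp add: algebra_simps)
  \<comment> \<open>The second difference of the cubic over -1, 0, 1 isolates the coefficient of
    \<open>x^2\<close>.\<close>
  have tr: "a - 1 - \<gamma> = l1 + l2 + l3"
    using fac'[of 0] fac'[of 1] fac'[of "-1"] by (simp add: field_simps)
  have "(1 + \<gamma> + t) * (\<gamma> - a + t) * (1 - a + t) - ?c\<^sup>2 * (1 - a + t) - ?b\<^sup>2 * (1 + \<gamma> + t) > 0"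
    if t: "t \<ge> 0" for t
  proof -
    have "0 < (t - (l1 + l2)) * (t - (l1 + l3)) * (t - (l2 + l3))"
      using t l by (intro mult_pos_pos) auto
    \<comment> \<open>This is the characteristic polynomial at \<open>tr(S) - t\<close>, where
      \<open>tr(S) - t - l3 = l1 + l2 - t\<close>, and similarly for the other two factors.\<close>
    also have "\<dots> = - ((a - 1 - \<gamma> - t - l1) * (a - 1 - \<gamma> - t - l2) * (a - 1 - \<gamma> - t - l3))"
      unfolding tr by (simp add: algebra_simps)
    also have "\<dots> = (1 + \<gamma> + t) * (\<gamma> - a + t) * (1 - a + t) - ?c\<^sup>2 * (1 - a + t) - ?b\<^sup>2 * (1 + \<gamma> + t)"
      unfolding fac'[symmetric] by (simp add: algebra_simps)
    finally show ?thesis .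
  qed
  note * = symmetric_tridiagonal_posdef[OF this]
  show "1 - a > 0" "\<gamma> - a > 0" "1 + \<gamma> > 0" using * by simp_all
  show "4 * ((1 - a) * (\<gamma> - a)) > (1 + \<beta>)\<^sup>2" "4 * ((\<gamma> - a) * (1 + \<gamma>)) > (1 + \<alpha>)\<^sup>2"
    using *(4,5) by (simp_all add: power_divide)
qed

section \<open>Second moments of the speed\<close>

lemma nonneg_binary_form_discriminant:
  fixes A B C :: real
  assumes "\<And>s t. s\<^sup>2 * A + 2 * s * t * B + t\<^sup>2 * C \<ge> 0"
  shows "B\<^sup>2 \<le> A * C"
proof (cases "C = 0")
  case True
  have "B = 0"
  proof (rule ccontr)
    assume "B \<noteq> 0"
    \<comment> \<open>These arguments make the form equal to -1.\<close>
    with assms[of 1 "- (A + 1) / (2 * B)"] True show False by (simp add: field_simps)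
  qed
  with True show ?thesis by simp
next
  case False
  then have "C > 0" using assms[of 0 1] by simp
  have "C * (A * C - B\<^sup>2) \<ge> 0"
    \<comment> \<open>For \<open>s = C\<close> the form is minimal at
      \<open>t = - B\<close>.\<close>
    using assms[of C "- B"] by (simp add: power2_eq_square algebra_simps)
  with \<open>C > 0\<close> show ?thesis by (simp add: zero_le_mult_iff)
qed

lemma psd_minors_3:
  fixes R :: "real ^ 3 ^ 3"
  assumes sym: "\<And>i j. R $ i $ j = R $ j $ i" and psd: "\<And>\<xi>. \<xi> \<bullet> (R *v \<xi>) \<ge> 0"
  shows "R $ 1 $ 1 \<ge> 0" "R $ 2 $ 2 \<ge> 0" "R $ 3 $ 3 \<ge> 0"
    "(R $ 1 $ 2)\<^sup>2 \<le> R $ 1 $ 1 * R $ 2 $ 2" "(R $ 2 $ 3)\<^sup>2 \<le> R $ 2 $ 2 * R $ 3 $ 3"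
    "(R $ 1 $ 3)\<^sup>2 \<le> R $ 1 $ 1 * R $ 3 $ 3"
proof -
  have form: "x\<^sup>2 * R $ 1 $ 1 + y\<^sup>2 * R $ 2 $ 2 + z\<^sup>2 * R $ 3 $ 3 +
      2 * x * y * R $ 1 $ 2 + 2 * x * z * R $ 1 $ 3 + 2 * y * z * R $ 2 $ 3 \<ge> 0" for x y z
    using psd[of "vector [x, y, z]"] sym[of 2 1] sym[of 3 1] sym[of 3 2]
    by (simp add: inner_vec_def matrix_vector_mult_def sum_3 power2_eq_square algebra_simps)
  show "R $ 1 $ 1 \<ge> 0" "R $ 2 $ 2 \<ge> 0" "R $ 3 $ 3 \<ge> 0"
    using form[of 1 0 0] form[of 0 1 0] form[of 0 0 1] by simp_all
  show "(R $ 1 $ 2)\<^sup>2 \<le> R $ 1 $ 1 * R $ 2 $ 2"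
    by (rule nonneg_binary_form_discriminant) (use form[where z = 0] in \<open>simp add: algebra_simps\<close>)
  show "(R $ 2 $ 3)\<^sup>2 \<le> R $ 2 $ 2 * R $ 3 $ 3"
    by (rule nonneg_binary_form_discriminant) (use form[where x = 0] in \<open>simp add: algebra_simps\<close>)
  show "(R $ 1 $ 3)\<^sup>2 \<le> R $ 1 $ 1 * R $ 3 $ 3"
    by (rule nonneg_binary_form_discriminant) (use form[where y = 0] in \<open>simp add: algebra_simps\<close>)
qed

text \<open>The case \<open>\<alpha> > 0 > \<beta>\<close> of \<open>moments_vanish\<close>, with \<open>p = 1 - a\<close>, \<open>r = 1 + \<gamma>\<close> and
  \<open>s = 1 + \<beta> r22 / r33\<close>.\<close>

lemma quadrant_certificate:
  fixes r s \<alpha> p :: real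
  assumes r: "r > 0" and p: "p > 0" and q: "p + r - 2 > 0"
    and qr: "4 * ((p + r - 2) * r) > (1 + \<alpha>)\<^sup>2"
    and \<alpha>: "\<alpha> > 0" and s: "0 \<le> s" "s \<le> 1"
    and ps: "p * s \<le> r" and rs: "(r - s)\<^sup>2 \<le> \<alpha> * (s * (1 - s))"
  shows False
proof -
  have "s \<noteq> 0" using rs r by auto
  then have s0: "s > 0" using s by simp
  have "s \<noteq> 1"
  proof
    assume "s = 1"
    with rs have "r = 1" by simp
    with \<open>s = 1\<close> ps q show False by simp
  qed
  then have s1: "s < 1" using s by simp
  \<comment> \<open>Adding \<open>s * (1 - s)\<close> to both sides of \<open>rs\<close> turns
    \<alpha> into \<open>1 + \<alpha>\<close>, the quantity in \<open>qr\<close>. After squaring,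
    \<open>qr\<close> eliminates \<alpha> and \<open>ps\<close> eliminates \<open>p\<close>; a
    polynomial inequality in \<open>r\<close> and \<open>s\<close> remains.\<close>
  define X where "X = r\<^sup>2 - 2 * r * s + s"
  define t where "t = - s * (1 - s - 3 * s\<^sup>2 + 2 * s ^ 3)"
  have X: "X \<le> (1 + \<alpha>) * (s * (1 - s))"
    using rs by (simp add: X_def power2_eq_square algebra_simps)
  have "X = (r - s)\<^sup>2 + s * (1 - s)" by (simp add: X_def power2_eq_square algebra_simps)
  then have X0: "X \<ge> 0" using s0 s1 by simp
  have "X\<^sup>2 \<le> ((1 + \<alpha>) * (s * (1 - s)))\<^sup>2" using X X0 by (rule power_mono)
  also have "\<dots> = (1 + \<alpha>)\<^sup>2 * (s * (1 - s))\<^sup>2" by (simp add: power_mult_distrib)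
  also have "\<dots> < 4 * ((p + r - 2) * r) * (s * (1 - s))\<^sup>2"
    using qr s0 s1 by (intro mult_strict_right_mono) auto
  also have "\<dots> = 4 * r * (s * (1 - s)\<^sup>2) * (p * s + r * s - 2 * s)"
    by (simp add: power2_eq_square algebra_simps)
  also have "\<dots> \<le> 4 * r * (s * (1 - s)\<^sup>2) * (r + r * s - 2 * s)"
    using r s0 ps by (intro mult_left_mono) auto
  finally have "X\<^sup>2 - 4 * r * (s * (1 - s)\<^sup>2) * (r + r * s - 2 * s) < 0" by simp
  \<comment> \<open>Completing the square in \<open>r\<close> with a correction \<open>t\<close> chosen so that the remainder is a nonnegative
    quadratic in \<open>r\<close>.\<close>
  also have "X\<^sup>2 - 4 * r * (s * (1 - s)\<^sup>2) * (r + r * s - 2 * s) =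
      (r\<^sup>2 - 2 * s * r + t)\<^sup>2 +
      s\<^sup>2 * (1 - s) * (2 * (r - s * (3 - 2 * s))\<^sup>2 + s * ((1 - s) * (2 - s)) * (2 * s - 1)\<^sup>2)"
    unfolding X_def t_def by algebra
  finally show False using s0 s1 by (smt (verit) mult_nonneg_nonneg zero_le_power2)
qed

text \<open>Through \<open>e2\<close>, \<open>e3\<close> and \<open>e5\<close> everything in
  \<open>e1\<close> and in the minors \<open>m12\<close>, \<open>m23\<close> is expressed by
  \<open>r22\<close> and \<open>r33\<close>. If \<open>r33 > 0\<close>, the signs of \<alpha> and
  \<beta> decide: both positive contradicts \<open>e5\<close>; both negative contradicts
  \<open>e1\<close> with \<open>r11 \<ge> 0\<close>; \<alpha> < 0 < \<beta> uses \<open>m23\<close>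
  and \<open>pq\<close>; the last quadrant uses \<open>m12\<close> and \<open>qr\<close>.\<close>

lemma moments_vanish:
  fixes \<alpha> \<beta> \<gamma> a r11 r22 r33 r12 r23 r13 :: real
  assumes \<alpha>: "\<alpha> \<noteq> 0" and \<beta>: "\<beta> \<noteq> 0"
    and p: "1 - a > 0" and q: "\<gamma> - a > 0" and r: "1 + \<gamma> > 0"
    and pq: "4 * ((1 - a) * (\<gamma> - a)) > (1 + \<beta>)\<^sup>2"
    and qr: "4 * ((\<gamma> - a) * (1 + \<gamma>)) > (1 + \<alpha>)\<^sup>2"
    and nn: "r11 \<ge> 0" "r22 \<ge> 0" "r33 \<ge> 0"
    and m12: "r12\<^sup>2 \<le> r11 * r22" and m23: "r23\<^sup>2 \<le> r22 * r33" and m13: "r13\<^sup>2 \<le> r11 * r33"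
    and e1: "a * r11 + \<alpha> * r12 \<ge> 0"
    and e2: "r22 = r12 + r23"
    and e3: "\<beta> * r23 = \<gamma> * r33"
    and e4: "r13 - r23 + r33 + \<beta> * r22 - \<gamma> * r23 = 0"
    and e5: "\<beta> * r11 / \<alpha> + \<beta> * r22 + r33 = 0"
  shows "r11 = 0 \<and> r22 = 0 \<and> r33 = 0"
proof -
  have "r33 = 0"
  proof (rule ccontr)
    assume "r33 \<noteq> 0"
    then have v: "r33 > 0" using nn by simp
    have r11: "r11 = - \<alpha> * (r22 + r33 / \<beta>)" using e5 \<alpha> \<beta> by (simp add: field_simps)
    have r23: "r23 = \<gamma> * r33 / \<beta>" using e3 \<beta> by (simp add: field_simps)
    have r12: "r12 = r22 - \<gamma> * r33 / \<beta>" using e2 r23 by simp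
    have "\<alpha> * ((1 - a) * r22 - (a + \<gamma>) * r33 / \<beta>) = a * r11 + \<alpha> * r12"
      unfolding r11 r12 using \<beta> by (simp add: field_simps)
    then have e1': "\<alpha> * ((1 - a) * r22 - (a + \<gamma>) * r33 / \<beta>) \<ge> 0" using e1 by simp
    have m23': "\<gamma>\<^sup>2 * r33 \<le> \<beta>\<^sup>2 * r22"
    proof -
      have "(\<gamma>\<^sup>2 * r33) * r33 = \<beta>\<^sup>2 * r23\<^sup>2" unfolding r23 using \<beta> by (simp add: power2_eq_square)
      also have "\<dots> \<le> \<beta>\<^sup>2 * (r22 * r33)" by (intro mult_left_mono m23) simp
      finally have "(\<gamma>\<^sup>2 * r33) * r33 \<le> (\<beta>\<^sup>2 * r22) * r33" by (simp add: mult.assoc)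
      then show ?thesis using v by simp
    qed
    consider "\<alpha> > 0" "\<beta> > 0" | "\<alpha> < 0" "\<beta> > 0" | "\<alpha> < 0" "\<beta> < 0" | "\<alpha> > 0" "\<beta> < 0"
      using \<alpha> \<beta> by linarith
    then show False
    proof cases
      case 1
      then have "\<beta> * r11 / \<alpha> \<ge> 0" "\<beta> * r22 \<ge> 0" using nn by auto
      then show False using e5 v by linarith
    next
      case 2
      from e1' 2 have "(1 - a) * r22 \<le> (a + \<gamma>) * r33 / \<beta>" by (simp add: zero_le_mult_iff)
      then have "\<beta>\<^sup>2 * ((1 - a) * r22) \<le> \<beta>\<^sup>2 * ((a + \<gamma>) * r33 / \<beta>)"
        by (rule mult_left_mono) simp
      also have "\<dots> = \<beta> * (a + \<gamma>) * r33" using \<beta> by (simp add: power2_eq_square)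
      finally have "(1 - a) * (\<beta>\<^sup>2 * r22) \<le> \<beta> * (a + \<gamma>) * r33" by (simp add: mult_ac)
      moreover have "(1 - a) * (\<gamma>\<^sup>2 * r33) \<le> (1 - a) * (\<beta>\<^sup>2 * r22)"
        using m23' p by (intro mult_left_mono) auto
      ultimately have "((1 - a) * \<gamma>\<^sup>2) * r33 \<le> (\<beta> * (a + \<gamma>)) * r33" by (simp add: mult.assoc)
      then have le: "(1 - a) * \<gamma>\<^sup>2 \<le> \<beta> * (a + \<gamma>)" using v by simp
      \<comment> \<open>From \<open>pq\<close> and \<open>(1 + \<beta>)^2 \<ge> 4 * \<beta>\<close>.
        Chained with \<open>le\<close> below, it leaves \<open>a = 0\<close> as the only
        possibility, which the strictness then excludes.\<close>
      have "(1 - a) * (\<gamma> - a) > \<beta>"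
        using pq zero_le_power2[of "1 - \<beta>"] by (simp add: power2_eq_square algebra_simps)
      moreover have "a + \<gamma> \<ge> 0"
      proof -
        have "0 \<le> (1 - a) * \<gamma>\<^sup>2" using p by simp
        then show ?thesis using le 2 by (metis order_trans zero_le_mult_iff not_less)
      qed
      ultimately have "\<beta> * (a + \<gamma>) \<le> (1 - a) * (\<gamma> - a) * (a + \<gamma>)" by (intro mult_right_mono) auto
      also have "\<dots> = (1 - a) * (\<gamma>\<^sup>2 - a\<^sup>2)" by (simp add: power2_eq_square algebra_simps)
      finally have "(1 - a) * a\<^sup>2 \<le> 0" using le by (simp add: algebra_simps)
      then have "a = 0" using p by (simp add: mult_le_0_iff)
      then have "\<gamma> * \<gamma> \<le> \<beta> * \<gamma>" using le by (simp add: power2_eq_square)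
      then have "\<gamma> \<le> \<beta>" using q \<open>a = 0\<close> by simp
      with \<open>(1 - a) * (\<gamma> - a) > \<beta>\<close> \<open>a = 0\<close> show False by simp
    next
      case 3
      from e1' 3 have h: "(1 - a) * r22 \<le> (a + \<gamma>) * r33 / \<beta>" by (simp add: zero_le_mult_iff)
      have "r22 + r33 / \<beta> \<ge> 0" using nn(1) 3 unfolding r11 by (simp add: mult_le_0_iff)
      then have "(1 - a) * (r22 + r33 / \<beta>) \<ge> 0" using p by simp
      with h have "0 \<le> (1 + \<gamma>) * r33 / \<beta>"
        by (simp add: add_divide_distrib diff_divide_distrib algebra_simps)
      moreover have "(1 + \<gamma>) * r33 / \<beta> < 0" using 3 r v by (simp add: divide_pos_neg)
      ultimately show False by simp
    next
      case 4
      \<comment> \<open>In terms of \<open>s\<close>, \<open>r22 \<ge> 0\<close> and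
        \<open>r11 \<ge> 0\<close> read \<open>s \<le> 1\<close> and \<open>s \<ge> 0\<close>,
        \<open>e1\<close> becomes \<open>ps\<close>, and \<open>m12\<close> becomes a quadratic
        inequality free of \<open>r33\<close>.\<close>
      define s where "s = 1 + \<beta> * r22 / r33"
      have u: "r22 = (s - 1) * r33 / \<beta>" using v \<beta> by (simp add: s_def)
      have s1: "s \<le> 1" using 4 nn v by (simp add: s_def divide_nonpos_pos mult_nonpos_nonneg)
      have r11': "r11 = - \<alpha> * s * r33 / \<beta>" unfolding r11 u using \<beta> by (simp add: field_simps)
      have s0: "s \<ge> 0"
      proof (rule ccontr)
        assume "\<not> s \<ge> 0"
        then have "\<alpha> * s * r33 < 0" using 4 v by (simp add: mult_pos_neg mult_neg_pos)
        then have "r11 < 0" unfolding r11' using 4 by (simp add: divide_neg_neg)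
        then show False using nn by simp
      qed
      have r12': "r12 = (s - 1 - \<gamma>) * r33 / \<beta>" unfolding r12 u using \<beta> by (simp add: field_simps)
      from e1' 4 have "0 \<le> (1 - a) * r22 - (a + \<gamma>) * r33 / \<beta>" by (simp add: zero_le_mult_iff)
      also have "\<dots> = ((1 - a) * s - (1 + \<gamma>)) * r33 / \<beta>" unfolding u using \<beta> by (simp add: field_simps)
      finally have ps: "(1 - a) * s \<le> 1 + \<gamma>"
        using 4 v by (simp add: zero_le_divide_iff zero_le_mult_iff mult_le_0_iff)
      have "(1 + \<gamma> - s)\<^sup>2 * (r33 / \<beta>)\<^sup>2 = r12\<^sup>2"
        unfolding r12' using \<beta> by (simp add: power2_eq_square field_simps)
      also have "\<dots> \<le> r11 * r22" by (rule m12)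
      also have "\<dots> = (\<alpha> * (s * (1 - s))) * (r33 / \<beta>)\<^sup>2"
        unfolding r11' u using \<beta> by (simp add: power2_eq_square field_simps)
      finally have "(1 + \<gamma> - s)\<^sup>2 \<le> \<alpha> * (s * (1 - s))" using v \<beta> by simp
      with quadrant_certificate[of "1 + \<gamma>" "1 - a" \<alpha> s] r p q qr 4 s0 s1 ps
      show False by (simp add: algebra_simps)
    qed
  qed
  \<comment> \<open>Once \<open>r33 = 0\<close>, the minors kill \<open>r23\<close> and
    \<open>r13\<close>, and \<open>e4\<close> reduces to \<open>\<beta> * r22 = 0\<close>.\<close>
  moreover from this m23 m13 have "r23 = 0" "r13 = 0" by simp_all
  ultimately have "r22 = 0" using e4 \<beta> by simp
  with \<open>r33 = 0\<close> show ?thesis using e5 \<alpha> \<beta> by simp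
qed

text \<open>The counterpart for \<beta> = 0. Here \<open>r12 = r22\<close> and
  \<open>r11 = - \<alpha> * r22\<close>, so a nonzero \<open>r22\<close> would need \<alpha> > 0 by
  \<open>e1\<close> and \<alpha> < 0 by \<open>r11 \<ge> 0\<close>.\<close>

lemma decoupled_moments_vanish:
  fixes \<alpha> a r11 r22 r33 r12 r23 r13 :: real
  assumes \<alpha>: "\<alpha> \<noteq> 0" and p: "1 - a > 0"
    and nn: "r11 \<ge> 0" "r22 \<ge> 0"
    and m23: "r23\<^sup>2 \<le> r22 * r33"
    and e1: "a * r11 + \<alpha> * r12 \<ge> 0"
    and e2: "r22 = r12 + r23"
    and e3: "r33 = 0"
    and e4: "r11 / \<alpha> + r22 = 0"
  shows "r11 = 0 \<and> r22 = 0 \<and> r33 = 0"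
proof -
  have "r23 = 0" using m23 e3 by simp
  have r11: "r11 = - \<alpha> * r22" using e4 \<alpha> by (simp add: field_simps)
  have "r22 = 0"
  proof (rule ccontr)
    assume "r22 \<noteq> 0"
    then have "r22 > 0" using nn by simp
    have "\<alpha> * ((1 - a) * r22) \<ge> 0" using e1 e2 \<open>r23 = 0\<close> r11 by (simp add: algebra_simps)
    moreover have "(1 - a) * r22 > 0" using p \<open>r22 > 0\<close> by simp
    ultimately have "\<alpha> > 0" using \<alpha> by (simp only: zero_le_mult_iff) linarith
    then have "r11 < 0" using r11 \<open>r22 > 0\<close> by simp
    then show False using nn by simp
  qed
  with r11 e3 show ?thesis by simp
qed

section \<open>Averaging along bounded trajectories\<close>

lemma has_integral_deriv_atLeast:
  fixes F :: "real \<Rightarrow> real"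
  assumes "\<And>t. t \<ge> 0 \<Longrightarrow> (F has_real_derivative F' t) (at t within {0..})" and "0 \<le> s" "s \<le> t"
  shows "(F' has_integral (F t - F s)) {s..t}"
proof (rule fundamental_theorem_of_calculus)
  fix x assume "x \<in> {s..t}"
  then have "(F has_real_derivative F' x) (at x within {s..t})"
    using assms by (intro has_field_derivative_subset[OF assms(1)]) auto
  then show "(F has_vector_derivative F' x) (at x within {s..t})"
    by (simp add: has_real_derivative_iff_has_vector_derivative)
qed fact

definition outer :: "real ^ 'n \<Rightarrow> real ^ 'n ^ 'n"
  where "outer v = (\<chi> i j. v $ i * v $ j)"

text \<open>Each \<open>L\<close> in \<open>\<L>\<close> is bounded below on the accumulated matrix
  \<open>M t\<close>, hence nonnegative on limits of its normalisations; \<open>rigid\<close>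
  excludes such a limit of norm one. So \<open>M\<close> is bounded, and its trace is the integral
  in question. An equality enters \<open>\<L>\<close> as the pair \<open>L\<close>,
  \<open>- L\<close>.\<close>

lemma energy_bounded:
  fixes v :: "real \<Rightarrow> real ^ 'n" and \<L> :: "(real ^ 'n ^ 'n \<Rightarrow> real) set"
  assumes cont: "continuous_on {0..} v"
    and rigid: "\<And>R. (\<And>i j. R $ i $ j = R $ j $ i) \<Longrightarrow> (\<And>\<xi>. \<xi> \<bullet> (R *v \<xi>) \<ge> 0) \<Longrightarrow>
      (\<And>L. L \<in> \<L> \<Longrightarrow> L R \<ge> 0) \<Longrightarrow> R = 0"
    and lin: "\<And>L. L \<in> \<L> \<Longrightarrow> linear L"
    and pot: "\<And>L. L \<in> \<L> \<Longrightarrow> \<exists>F F'. bounded (F ` {0..}) \<and>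
      (\<forall>t\<ge>0. (F has_real_derivative F' t) (at t within {0..}) \<and> F' t \<le> L (outer (v t)))"
  shows "\<exists>C. \<forall>t\<ge>0. integral {0..t} (\<lambda>s. (norm (v s))\<^sup>2) \<le> C"
proof -
  define M where "M t = integral {0..t} (\<lambda>s. outer (v s))" for t
  have co: "continuous_on {0..t} (\<lambda>s. outer (v s))" for t
    unfolding outer_def by (intro continuous_intros continuous_on_subset[OF cont]) auto
  have L_M: "((\<lambda>s. L (outer (v s))) has_integral L (M t)) {0..t}"
    if "linear L" for L :: "real ^ 'n ^ 'n \<Rightarrow> real" and t
    using has_integral_linear[OF integrable_integral[OF integrable_continuous_interval[OF co]]] that
    by (simp add: M_def o_def linear_conv_bounded_linear)
  have lin_ij: "linear (\<lambda>R. R $ i $ j - R $ j $ i)" for i j :: 'n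
    by (rule linearI) (simp_all add: algebra_simps)
  have lin_q: "linear (\<lambda>R. \<xi> \<bullet> (R *v \<xi>))" for \<xi> :: "real ^ 'n"
    by (rule linearI)
      (simp_all add: matrix_vector_mult_add_rdistrib inner_add_right flip: scaleR_matrix_vector_assoc)
  have lin_tr: "linear (\<lambda>R :: real ^ 'n ^ 'n. \<Sum>i\<in>UNIV. R $ i $ i)"
    by (rule linearI) (simp_all add: sum.distrib sum_distrib_left)
  have sym: "M t $ i $ j = M t $ j $ i" for t i j
    using L_M[OF lin_ij[of i j], of t] by (simp add: outer_def mult.commute has_integral_0_eq)
  have "\<xi> \<bullet> (outer w *v \<xi>) = (\<xi> \<bullet> w)\<^sup>2" for \<xi> w :: "real ^ 'n"
    by (simp add: outer_def inner_vec_def matrix_vector_mult_def power2_eq_square sum_product sum_distrib_left mult_ac)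
  then have psd: "\<xi> \<bullet> (M t *v \<xi>) \<ge> 0" for \<xi> t
    using L_M[OF lin_q[of \<xi>], of t] by (auto intro: has_integral_nonneg)
  have low: "\<exists>C. \<forall>t\<ge>0. L (M t) \<ge> - C" if "L \<in> \<L>" for L
  proof -
    obtain F F' where F: "bounded (F ` {0..})"
      "\<And>t. t \<ge> 0 \<Longrightarrow> (F has_real_derivative F' t) (at t within {0..})"
      "\<And>t. t \<ge> 0 \<Longrightarrow> F' t \<le> L (outer (v t))"
      using pot[OF \<open>L \<in> \<L>\<close>] by blast
    obtain B where B: "\<And>t. t \<ge> 0 \<Longrightarrow> \<bar>F t\<bar> \<le> B"
      using F(1) unfolding bounded_iff by auto
    have "L (M t) \<ge> - (2 * B)" if "t \<ge> 0" for t
    proof -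
      have "F t - F 0 \<le> L (M t)"
        using has_integral_le[OF has_integral_deriv_atLeast[OF F(2), of 0 t] L_M[OF lin[OF \<open>L \<in> \<L>\<close>], of t]] F(3) that
        by auto
      then show ?thesis using B[of t] B[of 0] that by auto
    qed
    then show ?thesis by blast
  qed
  have "\<exists>K. \<forall>t\<ge>0. norm (M t) \<le> K"
  proof (rule ccontr)
    assume "\<nexists>K. \<forall>t\<ge>0. norm (M t) \<le> K"
    then have "\<forall>n::nat. \<exists>t\<ge>0. norm (M t) > real (Suc n)" by (meson not_less)
    then obtain T where T: "\<And>n. T n \<ge> 0" "\<And>n::nat. norm (M (T n)) > real (Suc n)" by metis
    have pos: "norm (M (T n)) > 0" for n using T(2)[of n] by linarith
    \<comment> \<open>The divisor is the norm of \<open>M\<close>, not the time: the lower bounds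
      from \<open>low\<close> are constants, so they vanish in the limit however slowly
      \<open>M\<close> grows.\<close>
    define \<rho> where "\<rho> n = (1 / norm (M (T n))) *\<^sub>R M (T n)" for n
    have "\<rho> n \<in> sphere 0 1" for n using pos[of n] by (simp add: \<rho>_def)
    then obtain R k where R: "R \<in> sphere 0 1" and k: "strict_mono k" and lim: "(\<rho> \<circ> k) \<longlonglongrightarrow> R"
      using compact_sphere[of 0 1] unfolding compact_def by metis
    have lim_L: "(\<lambda>n. L (\<rho> (k n))) \<longlonglongrightarrow> L R" if "linear L" for L :: "real ^ 'n ^ 'n \<Rightarrow> real"
      using bounded_linear.tendsto[OF _ lim] that by (simp add: linear_conv_bounded_linear o_def)
    have scale: "L (\<rho> n) = L (M (T n)) / norm (M (T n))" if "linear L" for L :: "real ^ 'n ^ 'n \<Rightarrow> real" and n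
      using linear_cmul[OF that] by (simp add: \<rho>_def)
    have "R $ i $ j = R $ j $ i" for i j
      using LIMSEQ_unique[OF lim_L[OF lin_ij[of i j]], of 0] by (simp add: \<rho>_def sym[of _ i j])
    moreover have "\<xi> \<bullet> (R *v \<xi>) \<ge> 0" for \<xi>
      using LIMSEQ_le_const[OF lim_L[OF lin_q[of \<xi>]], of 0] by (simp add: scale[OF lin_q] psd)
    moreover have "L R \<ge> 0" if "L \<in> \<L>" for L
    proof -
      obtain C where C: "\<And>t. t \<ge> 0 \<Longrightarrow> L (M t) \<ge> - C" using low[OF \<open>L \<in> \<L>\<close>] by blast
      have "- \<bar>C\<bar> / real (Suc n) \<le> L (\<rho> (k n))" for n
      proof -
        have "real (Suc n) \<le> norm (M (T (k n)))"
          using T(2)[of "k n"] seq_suble[OF k, of n] by linarith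
        then have "\<bar>C\<bar> / norm (M (T (k n))) \<le> \<bar>C\<bar> / real (Suc n)"
          using pos[of "k n"] by (intro divide_left_mono mult_pos_pos) auto
        moreover have "- \<bar>C\<bar> / norm (M (T (k n))) \<le> L (M (T (k n))) / norm (M (T (k n)))"
          using C[OF T(1), of "k n"] pos by (intro divide_right_mono) auto
        ultimately show ?thesis by (simp add: scale[OF lin[OF that]])
      qed
      moreover have "(\<lambda>n. - \<bar>C\<bar> / real (Suc n)) \<longlonglongrightarrow> 0"
        using LIMSEQ_Suc[OF lim_const_over_n[of "- \<bar>C\<bar>"]] by simp
      ultimately show ?thesis
        using LIMSEQ_le[OF _ lim_L[OF lin[OF that]]] by blast
    qed
    ultimately have "R = 0" by (rule rigid)
    with R show False by simp
  qed
  then obtain K where K: "\<And>t. t \<ge> 0 \<Longrightarrow> norm (M t) \<le> K" by blast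
  have "(norm w)\<^sup>2 = (\<Sum>i\<in>UNIV. outer w $ i $ i)" for w :: "real ^ 'n"
    unfolding power2_norm_eq_inner by (simp add: outer_def inner_vec_def)
  then have "integral {0..t} (\<lambda>s. (norm (v s))\<^sup>2) = (\<Sum>i\<in>UNIV. M t $ i $ i)" for t
    using L_M[OF lin_tr, of t] by (simp add: integral_unique)
  moreover have "(\<Sum>i\<in>UNIV. M t $ i $ i) \<le> real CARD('n) * K" if "t \<ge> 0" for t
  proof (rule sum_bounded_above)
    fix i :: 'n
    have "\<bar>M t $ i $ i\<bar> \<le> norm (M t)"
      using Finite_Cartesian_Product.norm_nth_le[of "M t" i] Finite_Cartesian_Product.norm_nth_le[of "M t $ i" i] by simp
    then show "M t $ i $ i \<le> K" using K[OF that] by simp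
  qed
  ultimately show ?thesis by metis
qed

section \<open>Decay of integrable functions and convergence to a zero set\<close>

text \<open>A late value \<open>h t \<ge> e\<close> would keep \<open>h\<close> above
  \<open>e / 2\<close> for a fixed time \<open>d\<close> and push the integral past its
  supremum.\<close>

lemma barbalat:
  fixes h :: "real \<Rightarrow> real"
  assumes nn: "\<And>t. t \<ge> 0 \<Longrightarrow> h t \<ge> 0"
    and lip: "\<And>s t. 0 \<le> s \<Longrightarrow> s \<le> t \<Longrightarrow> \<bar>h t - h s\<bar> \<le> B * (t - s)"
    and bd: "\<And>t. t \<ge> 0 \<Longrightarrow> integral {0..t} h \<le> C"
  shows "(h \<longlongrightarrow> 0) at_top"
proof (rule tendstoI)
  fix e :: real assume e: "e > 0"
  \<comment> \<open>The maximum makes \<open>d\<close> positive even if \<open>B\<close> is not;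
    over a time \<open>d\<close> the function falls by at most \<open>e / 2\<close>.\<close>
  define B' where "B' = max B 1"
  define d where "d = e / (2 * B')"
  have B': "B' \<ge> B" "B' > 0" by (simp_all add: B'_def)
  have d: "d > 0" using e B' by (simp add: d_def)
  have cont: "continuous_on {0..} h"
  proof (rule continuous_onI)
    fix s \<epsilon> :: real assume "s \<in> {0..}" "\<epsilon> > 0"
    have "dist (h x) (h s) \<le> \<epsilon>" if "x \<in> {0..}" "dist x s < \<epsilon> / B'" for x
    proof -
      have "\<bar>h x - h s\<bar> \<le> B * \<bar>x - s\<bar>"
        using lip[of x s] lip[of s x] that \<open>s \<in> {0..}\<close> by (cases "x \<le> s") (auto simp: abs_minus_commute)
      also have "\<dots> \<le> B' * \<bar>x - s\<bar>" using B' by (intro mult_right_mono) auto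
      also have "\<dots> \<le> \<epsilon>" using that B' by (simp add: dist_real_def field_simps)
      finally show ?thesis by (simp add: dist_real_def)
    qed
    then show "\<exists>d>0. \<forall>x\<in>{0..}. dist x s < d \<longrightarrow> dist (h x) (h s) \<le> \<epsilon>"
      using \<open>\<epsilon> > 0\<close> B' by (intro exI[of _ "\<epsilon> / B'"]) auto
  qed
  have int: "h integrable_on {s..t}" if "s \<ge> 0" for s t
    using that by (intro integrable_continuous_interval continuous_on_subset[OF cont]) auto
  define G where "G t = integral {0..t} h" for t
  have G: "G t = G s + integral {s..t} h" if "0 \<le> s" "s \<le> t" for s t
    unfolding G_def using that Henstock_Kurzweil_Integration.integral_combine[of 0 s t h] int by simp
  have mono: "G s \<le> G t" if "0 \<le> s" "s \<le> t" for s t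
    using G[OF that] that nn integral_nonneg[OF int[of s t]] by auto
  define l where "l = Sup (G ` {0..})"
  have bdd: "bdd_above (G ` {0..})" by (auto simp: G_def intro!: bdd_aboveI[of _ C] bd)
  have "\<exists>t0\<ge>0. G t0 > l - e / 2 * d"
    using less_cSup_iff[OF _ bdd, of "l - e / 2 * d"] e d by (auto simp: l_def)
  then obtain t0 where t0: "t0 \<ge> 0" "G t0 > l - e / 2 * d" by blast
  have "dist (h t) 0 < e" if t: "t \<ge> t0" for t
  proof (rule ccontr)
    assume "\<not> dist (h t) 0 < e"
    then have he: "h t \<ge> e" using nn t t0 by (simp add: dist_real_def)
    have "e / 2 \<le> h x" if x: "x \<in> {t..t + d}" for x
    proof -
      have "\<bar>h x - h t\<bar> \<le> B * (x - t)" using lip x t t0 by auto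
      also have "\<dots> \<le> B' * d" using x B' d by (intro mult_mono) auto
      also have "\<dots> = e / 2" using B' by (simp add: d_def)
      finally show ?thesis using he by linarith
    qed
    then have "integral {t..t + d} (\<lambda>_. e / 2) \<le> integral {t..t + d} h"
      using int t t0 by (intro integral_le) auto
    then have "e / 2 * d \<le> integral {t..t + d} h" using d by (simp add: mult.commute)
    then have "G (t + d) \<ge> G t + e / 2 * d" using G[of t "t + d"] t t0 d by simp
    moreover have "G (t + d) \<le> l" unfolding l_def using t t0 d by (intro cSup_upper bdd) auto
    ultimately show False using mono[of t0 t] t t0 by simp
  qed
  then show "\<forall>\<^sub>F t in at_top. dist (h t) 0 < e" by (auto simp: eventually_at_top_linorder)
qed

text \<open>On the compact set of points in the orbit closure at distance at least \<open>e\<close>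
  from the zeros, the norm of \<open>f\<close> has a positive minimum, so the orbit eventually
  avoids that set.\<close>

lemma tends_to_zero_set:
  fixes f :: "'a::heine_borel \<Rightarrow> 'b::real_normed_vector"
  assumes cont: "continuous_on UNIV f" and bd: "bounded (u ` {0..})"
    and lim: "((\<lambda>t. f (u t)) \<longlongrightarrow> 0) at_top"
  shows "tends_to_set u {p. f p = 0}"
  unfolding tends_to_set_def
proof (rule tendstoI)
  fix e :: real assume e: "e > 0"
  let ?S = "{p. f p = 0}"
  define K where "K = closure (u ` {0..}) \<inter> {p. e \<le> infdist p ?S}"
  have "compact K" unfolding K_def
    using bd by (intro compact_Int_closed closed_Collect_le continuous_intros) simp_all
  have ev: "\<forall>\<^sub>F t in at_top. u t \<notin> K"
  proof (cases "K = {}")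
    case False
    then obtain p where p: "p \<in> K" "\<And>q. q \<in> K \<Longrightarrow> norm (f p) \<le> norm (f q)"
      using continuous_attains_inf[OF \<open>compact K\<close> False continuous_on_norm[OF continuous_on_subset[OF cont]]]
      by auto
    have "f p \<noteq> 0" using p(1) e by (auto simp: K_def)
    then have "\<forall>\<^sub>F t in at_top. norm (f (u t)) < norm (f p)"
      using tendstoD[OF lim, of "norm (f p)"] by simp
    then show ?thesis by (rule eventually_mono) (use p(2) leD in blast)
  qed simp
  have "\<forall>\<^sub>F t in at_top. t \<ge> (0::real)" by (rule eventually_ge_at_top)
  with ev show "\<forall>\<^sub>F t in at_top. dist (infdist (u t) ?S) 0 < e"
  proof eventually_elim
    case (elim t)
    then have "u t \<in> closure (u ` {0..})" by (intro subsetD[OF closure_subset]) simp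
    with elim have "infdist (u t) ?S < e" by (simp add: K_def)
    then show ?case by (simp add: infdist_nonneg)
  qed
qed

lemma bounded_continuous_comp:
  fixes g :: "'a::heine_borel \<Rightarrow> 'b::metric_space"
  assumes "continuous_on UNIV g" "bounded (u ` S)"
  shows "bounded ((\<lambda>t. g (u t)) ` S)"
proof -
  have "compact (g ` closure (u ` S))"
    using assms by (intro compact_continuous_image) (auto intro: continuous_on_subset simp: compact_closure)
  then have "bounded (g ` closure (u ` S))" by (rule compact_imp_bounded)
  moreover have "(\<lambda>t. g (u t)) ` S \<subseteq> g ` closure (u ` S)"
    using closure_subset[of "u ` S"] by auto
  ultimately show ?thesis by (rule bounded_subset)
qed

section \<open>Bounded orbits of the Chua system\<close>

locale chua_orbit =
  fixes \<alpha> \<beta> \<gamma> m0 m1 x0 a :: real and u :: "real \<Rightarrow> real ^ 3"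
  assumes pos: "\<alpha> * m1 > 0"
    and a: "a = \<alpha> * (m0 - 1)"
    and sol: "solution (chua \<alpha> \<beta> \<gamma> m0 m1 x0) u"
    and bdd: "bounded (u ` {0..})"
begin

abbreviation "v t \<equiv> chua \<alpha> \<beta> \<gamma> m0 m1 x0 (u t)"

lemma alpha: "\<alpha> \<noteq> 0"
  using pos by auto

lemma v_nth:
  "v t $ 1 = a * u t $ 1 + \<alpha> * u t $ 2 - \<alpha> * m1 * u t $ 1 ^ 3 + \<alpha> * x0"
  "v t $ 2 = u t $ 1 - u t $ 2 + u t $ 3"
  "v t $ 3 = \<beta> * u t $ 2 - \<gamma> * u t $ 3"
  by (simp_all add: chua_def Let_def a)

lemma continuous_chua: "continuous_on UNIV (chua \<alpha> \<beta> \<gamma> m0 m1 x0)"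
proof -
  \<comment> \<open>The decomposition along the axes reduces continuity to that of the polynomial
    coordinates.\<close>
  have "chua \<alpha> \<beta> \<gamma> m0 m1 x0 =
    (\<lambda>p. (a * p $ 1 + \<alpha> * p $ 2 - \<alpha> * m1 * p $ 1 ^ 3 + \<alpha> * x0) *\<^sub>R axis 1 1 +
      (p $ 1 - p $ 2 + p $ 3) *\<^sub>R axis 2 1 + (\<beta> * p $ 2 - \<gamma> * p $ 3) *\<^sub>R axis 3 1)"
    by (auto simp: chua_def Let_def fun_eq_iff vec_eq_iff forall_3 axis_def a)
  then show ?thesis by (auto intro!: continuous_intros)
qed

lemma deriv_u: "t \<ge> 0 \<Longrightarrow> ((\<lambda>t. u t $ i) has_real_derivative v t $ i) (at t within {0..})"
  using sol bounded_linear.has_vector_derivative[OF bounded_linear_vec_nth]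
  unfolding solution_def has_real_derivative_iff_has_vector_derivative by blast

text \<open>The linearised equation \<open>v' = J(u) v\<close>; only its first row depends on the
  position.\<close>

lemma deriv_v:
  assumes "t \<ge> 0"
  shows "((\<lambda>t. v t $ 1) has_real_derivative
      a * v t $ 1 + \<alpha> * v t $ 2 - 3 * (\<alpha> * m1) * (u t $ 1)\<^sup>2 * v t $ 1) (at t within {0..})"
    and "((\<lambda>t. v t $ 2) has_real_derivative v t $ 1 - v t $ 2 + v t $ 3) (at t within {0..})"
    and "((\<lambda>t. v t $ 3) has_real_derivative \<beta> * v t $ 2 - \<gamma> * v t $ 3) (at t within {0..})"
  unfolding v_nth
  by (auto intro!: derivative_eq_intros deriv_u assms simp: v_nth power2_eq_square algebra_simps)

lemma continuous_u: "continuous_on {0..} u"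
  using sol unfolding solution_def continuous_on_eq_continuous_within
  by (auto intro: has_vector_derivative_continuous)

lemma continuous_v: "continuous_on {0..} v"
  using continuous_on_compose2[OF continuous_chua continuous_u] by auto

lemma continuous_chua_nth: "continuous_on UNIV (\<lambda>p. chua \<alpha> \<beta> \<gamma> m0 m1 x0 p $ i)"
  by (intro continuous_intros continuous_chua)

lemmas cont = continuous_intros continuous_chua_nth

text \<open>A controlled functional is nonnegative on every limit of the normalised matrices
  \<open>\<integral> v v\<^sup>T\<close>, because a bounded function has a bounded increment.\<close>

definition controlled :: "(real ^ 3 ^ 3 \<Rightarrow> real) \<Rightarrow> bool"
  where "controlled L \<longleftrightarrow> linear L \<and> (\<exists>F F'. bounded (F ` {0..}) \<and>
    (\<forall>t\<ge>0. (F has_real_derivative F' t) (at t within {0..}) \<and> F' t \<le> L (outer (v t))))"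

lemma controlledI:
  assumes "continuous_on UNIV g" "linear L"
    and "\<And>t. t \<ge> 0 \<Longrightarrow> ((\<lambda>t. g (u t)) has_real_derivative F' t) (at t within {0..})"
    and "\<And>t. t \<ge> 0 \<Longrightarrow> F' t \<le> L (outer (v t))"
  shows "controlled L"
  unfolding controlled_def using assms bounded_continuous_comp[OF assms(1) bdd] by blast

text \<open>An exact derivative serves both signs, via \<open>g\<close> and \<open>- g\<close>, so
  that \<open>L\<close> vanishes on the limit matrices.\<close>

lemma controlled_eqI:
  assumes "continuous_on UNIV g" "linear L"
    and "\<And>t. t \<ge> 0 \<Longrightarrow> ((\<lambda>t. g (u t)) has_real_derivative L (outer (v t))) (at t within {0..})"
  shows "controlled L \<and> controlled (\<lambda>R. - L R)"
proof
  show "controlled L" using controlledI[OF assms] by simp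
  show "controlled (\<lambda>R. - L R)"
    by (rule controlledI[where g = "\<lambda>p. - g p" and F' = "\<lambda>t. - L (outer (v t))"])
      (auto intro!: derivative_eq_intros assms(3) continuous_on_minus assms(1) linear_compose_neg assms(2))
qed

section \<open>Controlled functionals from the speed and the potential\<close>

text \<open>The cubic term contributes \<open>- 3 * (\<alpha> * m1) * (u t $ 1 * v t $ 1)^2\<close>,
  which is nonpositive because \<open>\<alpha> * m1 > 0\<close>; dropping it leaves a one-sided
  relation.\<close>

lemma controlled_speed_x: "controlled (\<lambda>R. a * R $ 1 $ 1 + \<alpha> * R $ 1 $ 2)"
proof (rule controlledI[where g = "\<lambda>p. (chua \<alpha> \<beta> \<gamma> m0 m1 x0 p $ 1)\<^sup>2 / 2" and
    F' = "\<lambda>t. v t $ 1 * (a * v t $ 1 + \<alpha> * v t $ 2 - 3 * (\<alpha> * m1) * (u t $ 1)\<^sup>2 * v t $ 1)"])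
  fix t :: real assume t: "t \<ge> 0"
  show "((\<lambda>t. (v t $ 1)\<^sup>2 / 2) has_real_derivative
      v t $ 1 * (a * v t $ 1 + \<alpha> * v t $ 2 - 3 * (\<alpha> * m1) * (u t $ 1)\<^sup>2 * v t $ 1)) (at t within {0..})"
    using t by (auto intro!: derivative_eq_intros deriv_v)
  have "0 \<le> 3 * (\<alpha> * m1) * (u t $ 1 * v t $ 1)\<^sup>2"
    using pos by simp
  then show "v t $ 1 * (a * v t $ 1 + \<alpha> * v t $ 2 - 3 * (\<alpha> * m1) * (u t $ 1)\<^sup>2 * v t $ 1)
      \<le> a * outer (v t) $ 1 $ 1 + \<alpha> * outer (v t) $ 1 $ 2"
    by (simp add: outer_def power2_eq_square algebra_simps)
qed (auto intro!: cont linearI simp: algebra_simps)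

text \<open>The last two rows of the linearised equation have constant coefficients, so the squares
  of \<open>v t $ 2\<close> and \<open>v t $ 3\<close> and their product have derivatives that are
  exactly quadratic in \<open>v\<close>.\<close>

lemma controlled_speed_y:
  "controlled (\<lambda>R. R $ 1 $ 2 - R $ 2 $ 2 + R $ 2 $ 3) \<and>
   controlled (\<lambda>R. - (R $ 1 $ 2 - R $ 2 $ 2 + R $ 2 $ 3))"
  by (rule controlled_eqI[where g = "\<lambda>p. (chua \<alpha> \<beta> \<gamma> m0 m1 x0 p $ 2)\<^sup>2 / 2"])
    (auto intro!: cont linearI derivative_eq_intros deriv_v simp: outer_def field_simps)

lemma controlled_speed_z:
  "controlled (\<lambda>R. \<beta> * R $ 2 $ 3 - \<gamma> * R $ 3 $ 3) \<and>
   controlled (\<lambda>R. - (\<beta> * R $ 2 $ 3 - \<gamma> * R $ 3 $ 3))"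
  by (rule controlled_eqI[where g = "\<lambda>p. (chua \<alpha> \<beta> \<gamma> m0 m1 x0 p $ 3)\<^sup>2 / 2"])
    (auto intro!: cont linearI derivative_eq_intros deriv_v simp: outer_def field_simps)

lemma controlled_speed_yz:
  "controlled (\<lambda>R. R $ 1 $ 3 - R $ 2 $ 3 + R $ 3 $ 3 + \<beta> * R $ 2 $ 2 - \<gamma> * R $ 2 $ 3) \<and>
   controlled (\<lambda>R. - (R $ 1 $ 3 - R $ 2 $ 3 + R $ 3 $ 3 + \<beta> * R $ 2 $ 2 - \<gamma> * R $ 2 $ 3))"
  by (rule controlled_eqI[where g = "\<lambda>p. chua \<alpha> \<beta> \<gamma> m0 m1 x0 p $ 2 * chua \<alpha> \<beta> \<gamma> m0 m1 x0 p $ 3"])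
    (auto intro!: cont linearI derivative_eq_intros deriv_v simp: outer_def algebra_simps)

text \<open>With \<open>D = diag(1/\<alpha>, 1, 1/\<beta>)\<close> the matrix \<open>D J\<close> is symmetric, so the system is a gradient flow
  for the possibly indefinite metric \<open>D\<close>. The function \<open>\<Phi>\<close> is the part of its potential that stays
  finite at \<open>\<beta> = 0\<close>; adding the rest gives the potential, multiplied by \<open>\<beta>\<close>, in
  \<open>controlled_potential\<close>.\<close>

definition \<Phi> :: "real ^ 3 \<Rightarrow> real"
  where "\<Phi> p = (m0 - 1) * (p $ 1)\<^sup>2 / 2 - m1 * (p $ 1) ^ 4 / 4 + x0 * p $ 1 +
    p $ 1 * p $ 2 - (p $ 2)\<^sup>2 / 2 + p $ 2 * p $ 3"

lemma continuous_\<Phi>: "continuous_on UNIV \<Phi>"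
  unfolding \<Phi>_def by (intro continuous_intros) auto

text \<open>Along the orbit the gradient of \<open>\<Phi>\<close> is
  \<open>(v t $ 1 / \<alpha>, v t $ 2, u t $ 2)\<close>; the chain rule does the rest.\<close>

lemma deriv_\<Phi>:
  assumes "t \<ge> 0"
  shows "((\<lambda>t. \<Phi> (u t)) has_real_derivative
    (v t $ 1)\<^sup>2 / \<alpha> + (v t $ 2)\<^sup>2 + u t $ 2 * v t $ 3) (at t within {0..})"
proof -
  have "v t $ 1 / \<alpha> = (m0 - 1) * u t $ 1 + u t $ 2 - m1 * (u t $ 1) ^ 3 + x0"
    using alpha by (simp add: v_nth(1) a field_simps)
  then have "(v t $ 1)\<^sup>2 / \<alpha> = ((m0 - 1) * u t $ 1 + u t $ 2 - m1 * (u t $ 1) ^ 3 + x0) * v t $ 1"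
    by (simp add: power2_eq_square flip: times_divide_eq_left)
  moreover have "(v t $ 2)\<^sup>2 = (u t $ 1 - u t $ 2 + u t $ 3) * v t $ 2"
    by (simp add: v_nth(2) power2_eq_square)
  moreover have "((\<lambda>t. \<Phi> (u t)) has_real_derivative
      ((m0 - 1) * u t $ 1 + u t $ 2 - m1 * (u t $ 1) ^ 3 + x0) * v t $ 1 +
      (u t $ 1 - u t $ 2 + u t $ 3) * v t $ 2 + u t $ 2 * v t $ 3) (at t within {0..})"
    unfolding \<Phi>_def
    by (auto intro!: derivative_eq_intros deriv_u assms simp: field_simps)
  ultimately show ?thesis by simp
qed

lemma controlled_potential:
  "controlled (\<lambda>R. \<beta> * R $ 1 $ 1 / \<alpha> + \<beta> * R $ 2 $ 2 + R $ 3 $ 3) \<and>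
   controlled (\<lambda>R. - (\<beta> * R $ 1 $ 1 / \<alpha> + \<beta> * R $ 2 $ 2 + R $ 3 $ 3))"
proof (rule controlled_eqI[where g = "\<lambda>p. \<beta> * \<Phi> p - \<gamma> * (p $ 3)\<^sup>2 / 2"])
  fix t :: real assume t: "t \<ge> 0"
  \<comment> \<open>The cross term \<open>\<beta> * u t $ 2 * v t $ 3\<close> from
    \<open>\<Phi>\<close> and the derivative of \<open>- \<gamma> * (p $ 3)^2 / 2\<close> combine
    into this square.\<close>
  have "v t $ 3 * v t $ 3 = (\<beta> * u t $ 2 - \<gamma> * u t $ 3) * v t $ 3" by (simp add: v_nth(3))
  then show "((\<lambda>t. \<beta> * \<Phi> (u t) - \<gamma> * (u t $ 3)\<^sup>2 / 2) has_real_derivative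
      \<beta> * outer (v t) $ 1 $ 1 / \<alpha> + \<beta> * outer (v t) $ 2 $ 2 + outer (v t) $ 3 $ 3) (at t within {0..})"
    using t by (auto intro!: derivative_eq_intros deriv_u deriv_\<Phi>
        simp: outer_def power2_eq_square algebra_simps)
qed (auto intro!: continuous_intros continuous_\<Phi> linearI simp: add_divide_distrib algebra_simps)

section \<open>The decoupled case \<beta> = 0\<close>

lemma decoupled_deriv:
  assumes "\<beta> = 0" "t \<ge> 0"
  shows "((\<lambda>t. v t $ 3) has_real_derivative - \<gamma> * v t $ 3) (at t within {0..})"
  by (rule DERIV_cong[OF deriv_v(3)]) (simp_all add: assms)

text \<open>For \<open>\<beta> = 0\<close> the speed \<open>v $ 3\<close> is exponential, hence of constant sign; this replaces the
  potential, which degenerates.\<close>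

lemma decoupled_sign:
  assumes "\<beta> = 0"
  shows "\<exists>\<kappa>. \<forall>t\<ge>0. \<bar>u t $ 2 * v t $ 3\<bar> \<le> \<kappa> * v t $ 3"
proof -
  have "((\<lambda>t. v t $ 3 * exp (\<gamma> * t)) has_real_derivative 0) (at t within {0..})" if "t \<in> {0..}" for t
    using that by (auto intro!: derivative_eq_intros decoupled_deriv[OF assms])
  then obtain c where c: "\<And>t. t \<ge> 0 \<Longrightarrow> v t $ 3 * exp (\<gamma> * t) = c"
    using has_field_derivative_zero_constant[of "{0..}" "\<lambda>t. v t $ 3 * exp (\<gamma> * t)"] by auto
  then have v3: "v t $ 3 = c * exp (- \<gamma> * t)" if "t \<ge> 0" for t
    using c[OF that] by (simp add: exp_minus field_simps)
  have "bounded ((\<lambda>t. u t $ 2) ` {0..})"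
    by (rule bounded_continuous_comp[OF _ bdd]) (intro continuous_intros)
  then obtain B where B: "\<And>t. t \<ge> 0 \<Longrightarrow> \<bar>u t $ 2\<bar> \<le> B" unfolding bounded_iff by auto
  \<comment> \<open>The constant sign turns the absolute value into a multiple of
    \<open>v t $ 3\<close>, the derivative of the bounded function \<open>u t $ 3\<close>.\<close>
  have "\<bar>u t $ 2 * v t $ 3\<bar> \<le> (B * sgn c) * v t $ 3" if "t \<ge> 0" for t
  proof -
    have "\<bar>u t $ 2 * v t $ 3\<bar> \<le> B * \<bar>v t $ 3\<bar>"
      unfolding abs_mult by (intro mult_right_mono B that) simp
    also have "\<bar>v t $ 3\<bar> = sgn c * v t $ 3"
      unfolding v3[OF that] by (simp add: abs_mult sgn_if)
    finally show ?thesis by (simp add: mult.assoc)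
  qed
  then show ?thesis by blast
qed

text \<open>Dividing the square of \<open>v t $ 3\<close> by \<open>2 * \<gamma>\<close> makes its
  derivative \<open>- (v t $ 3)^2\<close> for either sign of \<gamma>; for \<gamma> = 0 this speed
  is zero.\<close>

lemma controlled_speed_z_decoupled:
  assumes "\<beta> = 0"
  shows "controlled (\<lambda>R. - R $ 3 $ 3)"
proof (cases "\<gamma> = 0")
  case True
  then have "v t $ 3 = 0" for t using assms v_nth(3)[of t] by simp
  then show ?thesis
    by (intro controlledI[where g = "\<lambda>_. 0" and F' = "\<lambda>_. 0"])
      (auto intro!: linearI simp: outer_def)
next
  case False
  then show ?thesis
    by (intro controlledI[where g = "\<lambda>p. (chua \<alpha> \<beta> \<gamma> m0 m1 x0 p $ 3)\<^sup>2 / (2 * \<gamma>)"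
        and F' = "\<lambda>t. - (v t $ 3)\<^sup>2"])
      (auto intro!: cont linearI derivative_eq_intros decoupled_deriv[OF assms]
        simp: outer_def power2_eq_square)
qed

text \<open>Subtracting \<open>\<kappa> * p $ 3\<close> from \<open>\<Phi>\<close> and from
  \<open>- \<Phi>\<close> absorbs the cross term \<open>u t $ 2 * v t $ 3\<close> in both
  directions.\<close>

lemma controlled_potential_decoupled:
  assumes "\<beta> = 0"
  shows "controlled (\<lambda>R. R $ 1 $ 1 / \<alpha> + R $ 2 $ 2)" "controlled (\<lambda>R. - (R $ 1 $ 1 / \<alpha> + R $ 2 $ 2))"
proof -
  obtain \<kappa> where \<kappa>: "\<And>t. t \<ge> 0 \<Longrightarrow> \<bar>u t $ 2 * v t $ 3\<bar> \<le> \<kappa> * v t $ 3"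
    using decoupled_sign[OF assms] by blast
  show "controlled (\<lambda>R. R $ 1 $ 1 / \<alpha> + R $ 2 $ 2)"
  proof (rule controlledI[where g = "\<lambda>p. \<Phi> p - \<kappa> * p $ 3" and
      F' = "\<lambda>t. (v t $ 1)\<^sup>2 / \<alpha> + (v t $ 2)\<^sup>2 + u t $ 2 * v t $ 3 - \<kappa> * v t $ 3"])
    show "(v t $ 1)\<^sup>2 / \<alpha> + (v t $ 2)\<^sup>2 + u t $ 2 * v t $ 3 - \<kappa> * v t $ 3
        \<le> outer (v t) $ 1 $ 1 / \<alpha> + outer (v t) $ 2 $ 2" if "t \<ge> 0" for t
      using \<kappa>[OF that] by (simp add: outer_def power2_eq_square)
  qed (auto intro!: continuous_intros continuous_\<Phi> linearI derivative_eq_intros deriv_\<Phi> deriv_u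
      simp: add_divide_distrib algebra_simps)
  show "controlled (\<lambda>R. - (R $ 1 $ 1 / \<alpha> + R $ 2 $ 2))"
  proof (rule controlledI[where g = "\<lambda>p. - \<Phi> p - \<kappa> * p $ 3" and
      F' = "\<lambda>t. - ((v t $ 1)\<^sup>2 / \<alpha> + (v t $ 2)\<^sup>2 + u t $ 2 * v t $ 3) - \<kappa> * v t $ 3"])
    show "- ((v t $ 1)\<^sup>2 / \<alpha> + (v t $ 2)\<^sup>2 + u t $ 2 * v t $ 3) - \<kappa> * v t $ 3
        \<le> - (outer (v t) $ 1 $ 1 / \<alpha> + outer (v t) $ 2 $ 2)" if "t \<ge> 0" for t
      using \<kappa>[OF that] by (simp add: outer_def power2_eq_square)
  qed (auto intro!: continuous_intros continuous_\<Phi> linearI derivative_eq_intros deriv_\<Phi> deriv_u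
      simp: add_divide_distrib algebra_simps)
qed

section \<open>Integrability and decay of the speed\<close>

text \<open>The rigidity required by \<open>energy_bounded\<close>: the controlled functionals force
  the diagonal of \<open>R\<close> to vanish, and the minors then remove the off-diagonal
  entries.\<close>

lemma speed_square_integrable:
  assumes p: "1 - a > 0" and q: "\<gamma> - a > 0" and r: "1 + \<gamma> > 0"
    and pq: "4 * ((1 - a) * (\<gamma> - a)) > (1 + \<beta>)\<^sup>2"
    and qr: "4 * ((\<gamma> - a) * (1 + \<gamma>)) > (1 + \<alpha>)\<^sup>2"
  shows "\<exists>C. \<forall>t\<ge>0. integral {0..t} (\<lambda>s. (norm (v s))\<^sup>2) \<le> C"
proof (rule energy_bounded[where \<L> = "{L. controlled L}", OF continuous_v])
  fix R :: "real ^ 3 ^ 3"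
  assume sym: "\<And>i j. R $ i $ j = R $ j $ i" and psd: "\<And>\<xi>. \<xi> \<bullet> (R *v \<xi>) \<ge> 0"
    and ctrl: "\<And>L. L \<in> {L. controlled L} \<Longrightarrow> L R \<ge> 0"
  have ctrl': "L R \<ge> 0" if "controlled L" for L using ctrl that by simp
  note minors = psd_minors_3[OF sym psd]
  have e1: "a * R $ 1 $ 1 + \<alpha> * R $ 1 $ 2 \<ge> 0" using ctrl'[OF controlled_speed_x] .
  have e2: "R $ 2 $ 2 = R $ 1 $ 2 + R $ 2 $ 3"
    using controlled_speed_y[THEN conjunct1, THEN ctrl'] controlled_speed_y[THEN conjunct2, THEN ctrl'] by simp
  have diag: "R $ 1 $ 1 = 0 \<and> R $ 2 $ 2 = 0 \<and> R $ 3 $ 3 = 0"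
  proof (cases "\<beta> = 0")
    case True
    have "R $ 3 $ 3 = 0" using ctrl'[OF controlled_speed_z_decoupled[OF True]] minors(3) by simp
    moreover have "R $ 1 $ 1 / \<alpha> + R $ 2 $ 2 = 0"
      using controlled_potential_decoupled[OF True, THEN ctrl'] by simp
    ultimately show ?thesis
      by (intro decoupled_moments_vanish[OF alpha p minors(1,2) minors(5) e1 e2])
  next
    case False
    have "\<beta> * R $ 2 $ 3 = \<gamma> * R $ 3 $ 3"
      using controlled_speed_z[THEN conjunct1, THEN ctrl'] controlled_speed_z[THEN conjunct2, THEN ctrl'] by simp
    moreover have "R $ 1 $ 3 - R $ 2 $ 3 + R $ 3 $ 3 + \<beta> * R $ 2 $ 2 - \<gamma> * R $ 2 $ 3 = 0"
      using controlled_speed_yz[THEN conjunct1, THEN ctrl'] controlled_speed_yz[THEN conjunct2, THEN ctrl'] by simp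
    moreover have "\<beta> * R $ 1 $ 1 / \<alpha> + \<beta> * R $ 2 $ 2 + R $ 3 $ 3 = 0"
      using controlled_potential[THEN conjunct1, THEN ctrl'] controlled_potential[THEN conjunct2, THEN ctrl'] by simp
    ultimately show ?thesis
      by (intro moments_vanish[OF alpha False p q r pq qr minors e1 e2])
  qed
  with minors(4-6) have "R $ 1 $ 2 = 0" "R $ 2 $ 3 = 0" "R $ 1 $ 3 = 0" by simp_all
  with diag sym show "R = 0" by (simp add: vec_eq_iff forall_3)
qed (auto simp: controlled_def)

text \<open>The derivative of the squared speed is a continuous function \<open>g\<close> of the
  position, hence bounded on the orbit; this is the Lipschitz constant for
  \<open>barbalat\<close>.\<close>

lemma speed_tendsto_0:
  assumes "\<And>t. t \<ge> 0 \<Longrightarrow> integral {0..t} (\<lambda>s. (norm (v s))\<^sup>2) \<le> C"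
  shows "(v \<longlongrightarrow> 0) at_top"
proof -
  let ?f = "chua \<alpha> \<beta> \<gamma> m0 m1 x0"
  define g where "g p = 2 * (?f p $ 1 * (a * ?f p $ 1 + \<alpha> * ?f p $ 2 - 3 * (\<alpha> * m1) * (p $ 1)\<^sup>2 * ?f p $ 1) +
    ?f p $ 2 * (?f p $ 1 - ?f p $ 2 + ?f p $ 3) + ?f p $ 3 * (\<beta> * ?f p $ 2 - \<gamma> * ?f p $ 3))" for p
  have norm_v: "(norm (v t))\<^sup>2 = (v t $ 1)\<^sup>2 + (v t $ 2)\<^sup>2 + (v t $ 3)\<^sup>2" for t
    unfolding power2_norm_eq_inner by (simp add: inner_vec_def sum_3 power2_eq_square)
  have deriv: "((\<lambda>t. (norm (v t))\<^sup>2) has_real_derivative g (u t)) (at t within {0..})" if "t \<ge> 0" for t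
    unfolding norm_v g_def using that
    by (auto intro!: derivative_eq_intros deriv_v simp: algebra_simps)
  have "continuous_on UNIV g" unfolding g_def by (intro continuous_intros continuous_chua)
  then have "bounded ((\<lambda>t. g (u t)) ` {0..})" by (rule bounded_continuous_comp[OF _ bdd])
  then obtain B where B: "\<And>t. t \<ge> 0 \<Longrightarrow> \<bar>g (u t)\<bar> \<le> B" unfolding bounded_iff by auto
  have "B \<ge> 0" using B[of 0] by simp
  have "((\<lambda>t. (norm (v t))\<^sup>2) \<longlongrightarrow> 0) at_top"
  proof (rule barbalat)
    show "\<bar>(norm (v t))\<^sup>2 - (norm (v s))\<^sup>2\<bar> \<le> B * (t - s)" if "0 \<le> s" "s \<le> t" for s t
    proof -
      have "((\<lambda>t. g (u t)) has_integral (norm (v t))\<^sup>2 - (norm (v s))\<^sup>2) {s..t}"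
        using that by (intro has_integral_deriv_atLeast[where F = "\<lambda>t. (norm (v t))\<^sup>2"] deriv) auto
      from has_integral_bound_real[OF \<open>B \<ge> 0\<close> finite.emptyI this] show ?thesis using B that by auto
    qed
  qed (use assms in auto)
  then have "((\<lambda>t. norm (v t)) \<longlongrightarrow> 0) at_top"
    using tendsto_real_sqrt[of "\<lambda>t. (norm (v t))\<^sup>2" 0] by simp
  then show ?thesis by (rule tendsto_norm_zero_cancel)
qed

end

theorem theorem2:
  fixes \<alpha> \<beta> \<gamma> m0 m1 x0 l1 l2 l3 :: real and u :: "real \<Rightarrow> real ^ 3"
  assumes "\<alpha> * m1 > 0"
    and "uniquely_solvable (chua \<alpha> \<beta> \<gamma> m0 m1 x0)"
    and "eigenvalues_mset (symmetric_part (chua_J0 \<alpha> \<beta> \<gamma> m0)) = {#l1, l2, l3#}"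
    and "l1 \<ge> l2" and "l2 \<ge> l3"
    and "l1 + l2 < 0"
    and "solution (chua \<alpha> \<beta> \<gamma> m0 m1 x0) u"
    and "bounded (u ` {0..})"
  shows "tends_to_set u (stationary_set (chua \<alpha> \<beta> \<gamma> m0 m1 x0))"
proof -
  interpret chua_orbit \<alpha> \<beta> \<gamma> m0 m1 x0 "\<alpha> * (m0 - 1)" u
    using assms by unfold_locales auto
  obtain C where "\<And>t. t \<ge> 0 \<Longrightarrow> integral {0..t} (\<lambda>s. (norm (v s))\<^sup>2) \<le> C"
    using speed_square_integrable[OF chua_spectral_condition[OF assms(3-6)]] by blast
  then have "(v \<longlongrightarrow> 0) at_top" by (rule speed_tendsto_0)
  then show ?thesis
    unfolding stationary_set_def by (rule tends_to_zero_set[OF continuous_chua assms(8)])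
qed

end
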